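(* For every $\psi\in\mathbb{R}$, $$\frac{1}{1+e^{\psi}}=\frac12\, e^{-\psi/2}\int_0^\infty e^{-\psi^2\omega/2}\,p(\omega)\,d\omega,\qquad\text{where}\quad p(\omega)=\sum_{n=0}^\infty(-1)^n\,\frac{2n+1}{(2\pi\omega^3)^{1/2}}\,e^{-(2n+1)^2/(8\omega)},\quad \omega>0 .$$
   Context: The function $p$ is the density of the Pólya-Gamma distribution $\mathrm{PG}(1,0)$. *)

theory Defs
  imports "HOL-Analysis.Analysis"
begin

definition polya_gamma_term :: "nat \<Rightarrow> real \<Rightarrow> real" where
  "polya_gamma_term n \<omega> =
     (-1) ^ n * ((2 * real n + 1) / sqrt (2 * pi * \<omega> ^ 3)) * exp (- (2 * real n + 1)\<^sup>2 / (8 * \<omega>))"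

text \<open>The density of PG(1,0), supported on the positive half-line. It is given by its
  alternating-series formula, not derived from the random-variable description of PG(1,0).\<close>

definition polya_gamma_density :: "real \<Rightarrow> real" where
  "polya_gamma_density \<omega> = (if \<omega> > 0 then (\<Sum>n. polya_gamma_term n \<omega>) else 0)"

end

theory Submission
  imports Defs "HOL-Probability.Distributions" "HOL-Real_Asymp.Real_Asymp"
begin

text \<open>
  Up to sign, the \<open>n\<close>-th term of the density is twice the hitting time density of the level
  \<open>(2 n + 1) / 2\<close>, whose Laplace transform at \<open>\<psi>\<^sup>2 / 2\<close> is \<open>exp (- (2 n + 1) \<bar>\<psi>\<bar> / 2)\<close>. Summing
  the alternating geometric series gives \<open>1 / cosh (\<psi> / 2)\<close>. At \<open>\<psi> = 0\<close> all terms have the same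
  \<open>L\<^sup>1\<close> norm, so the series cannot be integrated termwise. It is therefore first rewritten (Euler
  transformation, applied twice) as a series of second differences, whose \<open>L\<^sup>1\<close> norms are
  \<open>O(1 / n\<^sup>2)\<close> uniformly in \<open>\<psi>\<close>; this covers every \<open>\<psi>\<close> at once.
\<close>

section \<open>Gaussian antiderivative and Laplace transform of the hitting time density\<close>

text \<open>This is the error function up to scaling, the building block of inverse Gaussian
  distribution functions. The fundamental theorem of calculus gives the derivative, the half-line
  Gaussian integral gives the limit at \<open>at_top\<close>, and oddness carries it over to
  \<open>at_bot\<close>.\<close>

lemma gaussian_antiderivative:
  obtains g :: "real \<Rightarrow> real" where
    "\<And>x. (g has_real_derivative exp (- x\<^sup>2)) (at x)" "g 0 = 0"
    "(g \<longlongrightarrow> sqrt pi / 2) at_top" "(g \<longlongrightarrow> - (sqrt pi / 2)) at_bot"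
proof -
  define g :: "real \<Rightarrow> real" where "g = (\<lambda>x. LBINT s=0..x. exp (- s\<^sup>2))"
  have deriv: "(g has_real_derivative exp (- x\<^sup>2)) (at x)" for x
  proof -
    \<comment> \<open>The fundamental theorem is applied on a compact interval; this choice of
      \<open>r\<close> makes both 0 and \<open>x\<close> interior points, so the derivative is
      two-sided.\<close>
    define r where "r = \<bar>x\<bar> + 1"
    have "((\<lambda>u. LBINT s=ereal 0..u. exp (- s\<^sup>2)) has_vector_derivative exp (- x\<^sup>2)) (at x within {-r..r})"
      by (rule interval_integral_FTC2) (auto simp: r_def intro!: continuous_intros)
    then have "(g has_vector_derivative exp (- x\<^sup>2)) (at x within {-r<..<r})"
      unfolding g_def zero_ereal_def by (rule has_vector_derivative_within_subset) auto
    moreover have "x \<in> {-r<..<r}" by (auto simp: r_def)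
    ultimately show ?thesis
      unfolding has_real_derivative_iff_has_vector_derivative
      using has_vector_derivative_within_open open_greaterThanLessThan by blast
  qed
  have top: "(g \<longlongrightarrow> sqrt pi / 2) at_top"
  proof -
    have "((\<lambda>y. \<integral>x. indicator {..y} x *\<^sub>R (indicator {0..} x *\<^sub>R exp (- x\<^sup>2)) \<partial>lborel)
        \<longlongrightarrow> (\<integral>x. indicator {0..} x *\<^sub>R exp (- x\<^sup>2 :: real) \<partial>lborel)) at_top"
      using gaussian_moment_0 by (intro tendsto_integral_at_top) (simp_all add: has_bochner_integral_iff)
    also have "(\<integral>x. indicator {0..} x *\<^sub>R exp (- x\<^sup>2 :: real) \<partial>lborel) = sqrt pi / 2"
      using gaussian_moment_0 by (rule has_bochner_integral_integral_eq)
    finally have lim: "((\<lambda>y. \<integral>x. indicator {..y} x *\<^sub>R (indicator {0..} x *\<^sub>R exp (- x\<^sup>2)) \<partial>lborel)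
        \<longlongrightarrow> sqrt pi / 2) at_top" .
    have ev: "eventually (\<lambda>y. (\<integral>x. indicator {..y} x *\<^sub>R (indicator {0..} x *\<^sub>R exp (- x\<^sup>2)) \<partial>lborel) = g y) at_top"
      using eventually_ge_at_top[of 0]
    proof eventually_elim
      case (elim y)
      have "g y = (LBINT x:{0..y}. exp (- x\<^sup>2))"
        unfolding g_def zero_ereal_def by (rule interval_integral_Icc) fact
      also have "\<dots> = (\<integral>x. indicator {..y} x *\<^sub>R (indicator {0..} x *\<^sub>R exp (- x\<^sup>2)) \<partial>lborel)"
        unfolding set_lebesgue_integral_def
        by (intro Bochner_Integration.integral_cong) (auto simp: indicator_def)
      finally show ?case by simp
    qed
    show ?thesis by (rule Lim_transform_eventually[OF lim ev])
  qed
  have odd: "g (- x) = - g x" for x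
  proof -
    have "g (- x) = (LBINT s=x..0. exp (- s\<^sup>2))"
      unfolding g_def by (subst interval_integral_reflect) simp
    then show ?thesis
      unfolding g_def by (subst interval_integral_endpoints_reverse) simp
  qed
  have "((\<lambda>x. - g (- x)) \<longlongrightarrow> - (sqrt pi / 2)) at_bot"
    by (intro tendsto_minus filterlim_compose[OF top] filterlim_uminus_at_top_at_bot)
  then have bot: "(g \<longlongrightarrow> - (sqrt pi / 2)) at_bot" by (simp add: odd)
  show ?thesis using that[OF deriv _ top bot] odd[of 0] by simp
qed

text \<open>The density of the first hitting time of level \<open>a\<close> by Brownian motion.\<close>

definition inv_gauss :: "real \<Rightarrow> real \<Rightarrow> real" where
  "inv_gauss a \<omega> = a / sqrt (2 * pi * \<omega> ^ 3) * exp (- a\<^sup>2 / (2 * \<omega>))"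

text \<open>The integrand is nonnegative and has an explicit antiderivative, so integrability and
  value both come from its limits at 0 and at infinity. Their difference is \<open>(exp (- a * b) -
  exp (a * b)) / 2 + (exp (- a * b) + exp (a * b)) / 2\<close>.\<close>

lemma inv_gauss_laplace:
  fixes a b :: real
  assumes a: "a > 0" and b: "b \<ge> 0"
  shows "set_integrable lborel {0<..} (\<lambda>\<omega>. exp (- (b\<^sup>2 * \<omega> / 2)) * inv_gauss a \<omega>)" (is ?int)
    and "(LINT \<omega>:{0<..}|lborel. exp (- (b\<^sup>2 * \<omega> / 2)) * inv_gauss a \<omega>) = exp (- a * b)" (is ?eq)
proof -
  obtain g :: "real \<Rightarrow> real" where
    deriv: "\<And>x. (g has_real_derivative exp (- x\<^sup>2)) (at x)" and g0: "g 0 = 0" and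
    top: "(g \<longlongrightarrow> sqrt pi / 2) at_top" and bot: "(g \<longlongrightarrow> - (sqrt pi / 2)) at_bot"
    using gaussian_antiderivative by blast
  define u where "u = (\<lambda>\<omega>. (b * \<omega> - a) / sqrt (2 * \<omega>))"
  define v where "v = (\<lambda>\<omega>. (- b * \<omega> - a) / sqrt (2 * \<omega>))"
  \<comment> \<open>The distribution function of the inverse Gaussian law with drift \<open>b\<close>, up to additive and
    multiplicative constants.\<close>
  define F where "F = (\<lambda>\<omega>. (exp (- a * b) * g (u \<omega>) + exp (a * b) * g (v \<omega>)) / sqrt pi)"
  define f where "f = (\<lambda>\<omega>. exp (- (b\<^sup>2 * \<omega> / 2)) * inv_gauss a \<omega>)"
  have du: "(u has_real_derivative (b * \<omega> + a) / (2 * \<omega> * sqrt (2 * \<omega>))) (at \<omega>)"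
    and dv: "(v has_real_derivative (- b * \<omega> + a) / (2 * \<omega> * sqrt (2 * \<omega>))) (at \<omega>)" if "\<omega> > 0" for \<omega>
    unfolding u_def v_def using that
    by (auto intro!: derivative_eq_intros simp: field_simps)
  have dF: "(F has_real_derivative f \<omega>) (at \<omega>)" if w: "\<omega> > 0" for \<omega>
  proof -
    \<comment> \<open>Expanding the squares of \<open>u\<close> and \<open>v\<close> produces cross
      terms that cancel against the factors \<open>exp (- a * b)\<close> and
      \<open>exp (a * b)\<close>, leaving the same exponential in both cases.\<close>
    have eu: "exp (- a * b) * exp (- (u \<omega>)\<^sup>2) = exp (- (b\<^sup>2 * \<omega> / 2)) * exp (- a\<^sup>2 / (2 * \<omega>))"
      and ev: "exp (a * b) * exp (- (v \<omega>)\<^sup>2) = exp (- (b\<^sup>2 * \<omega> / 2)) * exp (- a\<^sup>2 / (2 * \<omega>))"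
      unfolding exp_add[symmetric] u_def v_def using w
      by (simp_all add: power_divide) (simp_all add: field_simps power2_eq_square)
    have "(F has_real_derivative (exp (- a * b) * (exp (- (u \<omega>)\<^sup>2) * ((b * \<omega> + a) / (2 * \<omega> * sqrt (2 * \<omega>))))
      + exp (a * b) * (exp (- (v \<omega>)\<^sup>2) * ((- b * \<omega> + a) / (2 * \<omega> * sqrt (2 * \<omega>))))) / sqrt pi) (at \<omega>)"
      unfolding F_def using w
      by (intro DERIV_cdivide DERIV_add DERIV_cmult DERIV_chain2[OF deriv] du dv)
    also have "(exp (- a * b) * (exp (- (u \<omega>)\<^sup>2) * ((b * \<omega> + a) / (2 * \<omega> * sqrt (2 * \<omega>))))
      + exp (a * b) * (exp (- (v \<omega>)\<^sup>2) * ((- b * \<omega> + a) / (2 * \<omega> * sqrt (2 * \<omega>))))) / sqrt pi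
      = exp (- (b\<^sup>2 * \<omega> / 2)) * exp (- a\<^sup>2 / (2 * \<omega>)) *
        (((b * \<omega> + a) / (2 * \<omega> * sqrt (2 * \<omega>)) + (- b * \<omega> + a) / (2 * \<omega> * sqrt (2 * \<omega>))) / sqrt pi)"
      unfolding mult.assoc[symmetric] eu ev by (simp add: algebra_simps)
    \<comment> \<open>The two contributions proportional to \<open>b\<close> cancel, so only the
      level \<open>a\<close> survives.\<close>
    also have "((b * \<omega> + a) / (2 * \<omega> * sqrt (2 * \<omega>)) + (- b * \<omega> + a) / (2 * \<omega> * sqrt (2 * \<omega>))) / sqrt pi
       = a / (\<omega> * sqrt (2 * \<omega>) * sqrt pi)"
      unfolding add_divide_distrib[symmetric] using w by simp
    also have "\<omega> * sqrt (2 * \<omega>) * sqrt pi = sqrt (2 * pi * \<omega> ^ 3)"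
      using w by (simp add: real_sqrt_mult power3_eq_cube)
    finally show ?thesis unfolding f_def inv_gauss_def by (simp add: mult_ac)
  qed
  \<comment> \<open>Near 0 the term \<open>- a / sqrt (2 * \<omega>)\<close> dominates both
    arguments, so both go to minus infinity.\<close>
  have lim0: "(F \<longlongrightarrow> (exp (- a * b) * (- (sqrt pi / 2)) + exp (a * b) * (- (sqrt pi / 2))) / sqrt pi) (at_right 0)"
  proof -
    have "filterlim u at_bot (at_right 0)" "filterlim v at_bot (at_right 0)"
      unfolding u_def v_def using a by real_asymp+
    then show ?thesis unfolding F_def
      by (intro tendsto_intros filterlim_compose[OF bot]) auto
  qed
  have liminf: "(F \<longlongrightarrow> (exp (- a * b) - exp (a * b)) / 2) at_top"
  \<comment> \<open>Without drift, \<open>u\<close> and \<open>v\<close> tend to 0 rather than to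
    opposite infinities, so continuity of \<open>g\<close> at 0 replaces its limits at
    infinity.\<close>
  proof (cases "b = 0")
    case True
    have "(u \<longlongrightarrow> 0) at_top" "(v \<longlongrightarrow> 0) at_top"
      unfolding u_def v_def using a True by (simp_all, real_asymp+)
    moreover have "isCont g 0" using deriv DERIV_isCont by blast
    ultimately have "((\<lambda>x. g (u x)) \<longlongrightarrow> 0) at_top" "((\<lambda>x. g (v x)) \<longlongrightarrow> 0) at_top"
      using isCont_tendsto_compose[of 0 g] g0 by fastforce+
    then have "(F \<longlongrightarrow> (exp (- a * b) * 0 + exp (a * b) * 0) / sqrt pi) at_top"
      unfolding F_def by (intro tendsto_intros) auto
    then show ?thesis using True by simp
  next
    case False
    with b have "b > 0" by simp
    then have "filterlim u at_top at_top" "filterlim v at_bot at_top"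
      unfolding u_def v_def by real_asymp+
    then have "(F \<longlongrightarrow> (exp (- a * b) * (sqrt pi / 2) + exp (a * b) * (- (sqrt pi / 2))) / sqrt pi) at_top"
      unfolding F_def by (intro tendsto_intros filterlim_compose[OF bot] filterlim_compose[OF top]) auto
    also have "(exp (- a * b) * (sqrt pi / 2) + exp (a * b) * (- (sqrt pi / 2))) / sqrt pi
        = (exp (- a * b) - exp (a * b)) / 2"
      by (simp add: add_divide_distrib diff_divide_distrib)
    finally show ?thesis .
  qed
  have cont: "isCont f x" if "0 < ereal x" for x
    using that unfolding f_def inv_gauss_def by (auto intro!: continuous_intros)
  have nonneg: "f x \<ge> 0" if "0 < ereal x" for x
    using that a unfolding f_def inv_gauss_def by auto
  have 0: "((F \<circ> real_of_ereal) \<longlongrightarrow> - ((exp (- a * b) + exp (a * b)) / 2)) (at_right 0)"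
    using lim0 unfolding zero_ereal_def ereal_tendsto_simps
    by (simp add: add_divide_distrib diff_divide_distrib)
  have 1: "((F \<circ> real_of_ereal) \<longlongrightarrow> (exp (- a * b) - exp (a * b)) / 2) (at_left \<infinity>)"
    using liminf unfolding ereal_tendsto_simps .
  note FTC = interval_integral_FTC_nonneg[OF _ _ _ _ 0 1, of f]
  show ?int using FTC(1) dF cont nonneg
    by (simp add: f_def zero_ereal_def)
  show ?eq using FTC(2) dF cont nonneg
    by (simp add: f_def interval_lebesgue_integral_0_infty field_simps)
qed

section \<open>Second differences and the Euler transformation\<close>

text \<open>Two uses of the mean value theorem: first for the increment
  \<open>f (x + h) - f x\<close>, then for \<open>f'\<close> on an interval of length
  \<open>h\<close>.\<close>

lemma second_difference_mvt:
  fixes f f' f'' :: "real \<Rightarrow> real"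
  assumes h: "h > 0"
    and f: "\<And>x. (f has_real_derivative f' x) (at x)"
    and f': "\<And>x. (f' has_real_derivative f'' x) (at x)"
  obtains z where "m < z" "z < m + 2 * h" "f (m + 2 * h) - 2 * f (m + h) + f m = h\<^sup>2 * f'' z"
proof -
  have "((\<lambda>x. f (x + h) - f x) has_real_derivative f' (x + h) - f' x) (at x)" for x
    by (intro DERIV_diff f) (use f[of "x + h"] in \<open>simp add: DERIV_shift\<close>)
  then obtain y where y: "m < y" "y < m + h"
      "(f (m + h + h) - f (m + h)) - (f (m + h) - f m) = h * (f' (y + h) - f' y)"
    using MVT2[of m "m + h" "\<lambda>x. f (x + h) - f x" "\<lambda>x. f' (x + h) - f' x"] h by auto
  obtain z where z: "y < z" "z < y + h" "f' (y + h) - f' y = h * f'' z"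
    using MVT2[of y "y + h" f' f''] f' h by auto
  show ?thesis
    by (rule that[of z]) (use y z in \<open>auto simp: power2_eq_square algebra_simps\<close>)
qed

text \<open>With \<open>y = t * z\<^sup>2\<close>, the second derivative at \<open>z\<close> is
  \<open>y * (4 * y - 6) * exp (- y) / z\<close>. Sacrificing \<open>exp (3 * y / 4)\<close> to
  absorb the polynomial gains a factor \<open>1 / m\<close> and still leaves Gaussian decay; step
  width 2 contributes the factor 4 in 64.\<close>

lemma second_difference_gaussian_bound:
  fixes t m :: real
  defines "f \<equiv> (\<lambda>x. x * exp (- (t * x\<^sup>2)))"
  assumes t: "t > 0" and m: "m > 0"
  shows "\<bar>f (m + 4) - 2 * f (m + 2) + f m\<bar> \<le> 64 / m * exp (- (t * m\<^sup>2 / 4))"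
proof -
  have 1: "(f has_real_derivative (1 - 2 * t * x\<^sup>2) * exp (- (t * x\<^sup>2))) (at x)" for x
    unfolding f_def
    by (auto intro!: derivative_eq_intros simp: algebra_simps power2_eq_square)
  have 2: "((\<lambda>x. (1 - 2 * t * x\<^sup>2) * exp (- (t * x\<^sup>2))) has_real_derivative
      t * x * (4 * (t * x\<^sup>2) - 6) * exp (- (t * x\<^sup>2))) (at x)" for x
    by (auto intro!: derivative_eq_intros simp: algebra_simps power2_eq_square)
  obtain z where z: "m < z" and eq:
      "f (m + 4) - 2 * f (m + 2) + f m = 4 * (t * z * (4 * (t * z\<^sup>2) - 6) * exp (- (t * z\<^sup>2)))"
    using second_difference_mvt[OF _ 1 2, of 2 m] by auto
  define y where "y = t * z\<^sup>2"
  have y: "y \<ge> 0" using t by (simp add: y_def)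
  \<comment> \<open>The factor 16 gives the quadratic Taylor polynomial coefficients 12 and 9/2,
    which dominate 6 and 4.\<close>
  have "6 * y + 4 * y\<^sup>2 \<le> 16 * (1 + 3 * y / 4 + (3 * y / 4)\<^sup>2 / 2)"
    using y by (simp add: power_divide power_mult_distrib) (use zero_le_power2[of y] y in linarith)
  also have "\<dots> \<le> 16 * exp (3 * y / 4)"
    using exp_lower_Taylor_quadratic[of "3 * y / 4"] y by simp
  finally have poly_le: "6 * y + 4 * y\<^sup>2 \<le> 16 * exp (3 * y / 4)" .
  have "\<bar>t * z * (4 * (t * z\<^sup>2) - 6) * exp (- (t * z\<^sup>2))\<bar> = \<bar>y * (4 * y - 6)\<bar> * exp (- y) / z"
    using z m t by (simp add: y_def abs_mult power2_eq_square)
  also have "\<dots> \<le> 16 * exp (3 * y / 4) * exp (- y) / z"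
  proof -
    have "\<bar>y * (4 * y - 6)\<bar> \<le> 6 * y + 4 * y\<^sup>2"
      using y by (auto simp: abs_le_iff power2_eq_square algebra_simps)
    then show ?thesis using poly_le z m by (intro divide_right_mono mult_right_mono) auto
  qed
  also have "\<dots> = 16 / z * exp (- (t * z\<^sup>2 / 4))"
    by (simp add: exp_add[symmetric] y_def)
  also have "\<dots> \<le> 16 / m * exp (- (t * m\<^sup>2 / 4))"
    using z m t by (intro mult_mono divide_left_mono) (auto intro!: power_mono)
  finally show ?thesis unfolding eq by (simp add: abs_mult)
qed

text \<open>Each index shift drops the leading term and flips the sign: if \<open>A\<close> is the
  original sum, the shifted sums are \<open>x 0 - A\<close> and \<open>x 1 - x 0 + A\<close>.
  Solving the result for \<open>A\<close> gives the twofold Euler transformation.\<close>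

lemma alternating_sums_second_difference:
  fixes x :: "nat \<Rightarrow> real"
  assumes "summable (\<lambda>n. (-1) ^ n * x n)"
  shows "(\<lambda>n. (-1) ^ n * (x n - 2 * x (n + 1) + x (n + 2))) sums
    (4 * (\<Sum>n. (-1) ^ n * x n) - 3 * x 0 + x 1)"
proof -
  define A where "A = (\<Sum>n. (-1) ^ n * x n)"
  have 0: "(\<lambda>n. (-1) ^ n * x n) sums A" unfolding A_def using assms by (rule summable_sums)
  then have "(\<lambda>n. (-1) ^ Suc n * x (Suc n)) sums (A - x 0)"
    by (subst sums_Suc_iff) simp
  from sums_minus[OF this] have 1: "(\<lambda>n. (-1) ^ n * x (n + 1)) sums (x 0 - A)" by simp
  then have "(\<lambda>n. (-1) ^ Suc n * x (Suc n + 1)) sums (x 0 - A - x 1)"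
    by (subst sums_Suc_iff) simp
  from sums_minus[OF this] have 2: "(\<lambda>n. (-1) ^ n * x (n + 2)) sums (x 1 - x 0 + A)"
    by (simp add: algebra_simps)
  have "(\<lambda>n. (-1) ^ n * x n - 2 * ((-1) ^ n * x (n + 1)) + (-1) ^ n * x (n + 2)) sums
      (A - 2 * (x 0 - A) + (x 1 - x 0 + A))"
    by (intro sums_add sums_diff sums_mult 0 1 2)
  then show ?thesis by (simp add: A_def algebra_simps)
qed

section \<open>Convergence and domination of the density series\<close>

lemma summable_inverse_odd_squares: "summable (\<lambda>n. 1 / (2 * real n + 1)\<^sup>2)"
proof (rule summable_comparison_test')
  show "summable (\<lambda>n. 1 / (real (Suc n))\<^sup>2)"
    using inverse_squares_sums[THEN sums_summable] by (simp add: add.commute)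
  show "norm (1 / (2 * real n + 1)\<^sup>2) \<le> 1 / (real (Suc n))\<^sup>2" for n
    by (auto intro!: divide_left_mono power_mono mult_pos_pos)
qed

lemma abs_summable_polya_gamma_term:
  assumes w: "\<omega> > 0"
  shows "summable (\<lambda>n. \<bar>polya_gamma_term n \<omega>\<bar>)"
proof (rule summable_comparison_test')
  \<comment> \<open>The constant comes from \<open>exp (- y) \<le> 2 / y\<^sup>2\<close> at
    \<open>y = m\<^sup>2 / (8 * \<omega>)\<close>, which gives
    \<open>128 * \<omega>\<^sup>2 / m ^ 4\<close>.\<close>
  define C where "C = 128 * \<omega>\<^sup>2 / sqrt (2 * pi * \<omega> ^ 3)"
  show "summable (\<lambda>n. C * (1 / (2 * real n + 1)\<^sup>2))"
    by (intro summable_mult summable_inverse_odd_squares)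
  fix n :: nat
  define m where "m = 2 * real n + 1"
  define y where "y = m\<^sup>2 / (8 * \<omega>)"
  have m: "m \<ge> 1" by (simp add: m_def)
  have y: "y > 0" using w m by (simp add: y_def)
  have "exp y \<ge> y\<^sup>2 / 2" using exp_lower_Taylor_quadratic[of y] y by linarith
  then have "exp (- y) \<le> 2 / y\<^sup>2" using y by (simp add: exp_minus field_simps)
  also have "2 / y\<^sup>2 = 128 * \<omega>\<^sup>2 / m ^ 4"
    using w m by (simp add: y_def field_simps power2_eq_square power4_eq_xxxx)
  finally have "m * exp (- y) \<le> m * (128 * \<omega>\<^sup>2 / m ^ 4)"
    using m by (intro mult_left_mono) auto
  also have "\<dots> = 128 * \<omega>\<^sup>2 / m ^ 3"
    using m by (simp add: power3_eq_cube power4_eq_xxxx)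
  also have "\<dots> \<le> 128 * \<omega>\<^sup>2 / m\<^sup>2"
    using m by (intro divide_left_mono power_increasing) auto
  finally have "m * exp (- y) / sqrt (2 * pi * \<omega> ^ 3) \<le> 128 * \<omega>\<^sup>2 / m\<^sup>2 / sqrt (2 * pi * \<omega> ^ 3)"
    using w by (intro divide_right_mono) auto
  moreover have "\<bar>polya_gamma_term n \<omega>\<bar> = m * exp (- y) / sqrt (2 * pi * \<omega> ^ 3)"
    using w m by (simp add: polya_gamma_term_def m_def y_def abs_mult power_abs)
  ultimately show "norm \<bar>polya_gamma_term n \<omega>\<bar> \<le> C * (1 / (2 * real n + 1)\<^sup>2)"
    by (simp add: C_def m_def mult_ac)
qed

lemma polya_gamma_term_eq_inv_gauss:
  "polya_gamma_term n \<omega> = (-1) ^ n * (2 * inv_gauss ((2 * real n + 1) / 2) \<omega>)"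
  by (simp add: polya_gamma_term_def inv_gauss_def power_divide)

text \<open>Taking \<open>t = 1 / (8 * \<omega>)\<close>, the remaining Gaussian factor is that of a
  hitting time density of level \<open>m / 4\<close>. Its total mass is 1 for every
  \<open>m\<close>, so the second difference has \<open>L^1\<close> norm at most
  \<open>256 / m\<^sup>2\<close>.\<close>

lemma inv_gauss_second_difference_bound:
  assumes w: "\<omega> > 0" and m: "m > 0"
  shows "\<bar>2 * inv_gauss (m / 2) \<omega> - 2 * (2 * inv_gauss ((m + 2) / 2) \<omega>) + 2 * inv_gauss ((m + 4) / 2) \<omega>\<bar>
    \<le> 256 / m\<^sup>2 * inv_gauss (m / 4) \<omega>"
proof -
  define S where "S = sqrt (2 * pi * \<omega> ^ 3)"
  define f where "f = (\<lambda>x::real. x * exp (- (1 / (8 * \<omega>) * x\<^sup>2)))"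
  have S: "S > 0" using w by (simp add: S_def)
  have eq: "2 * inv_gauss (x / 2) \<omega> = f x / S" for x
    by (simp add: inv_gauss_def f_def S_def power_divide)
  have "\<bar>f (m + 4) - 2 * f (m + 2) + f m\<bar> \<le> 64 / m * exp (- (1 / (8 * \<omega>) * m\<^sup>2 / 4))"
    unfolding f_def by (rule second_difference_gaussian_bound) (use w m in auto)
  then have "\<bar>f (m + 4) - 2 * f (m + 2) + f m\<bar> / S \<le> 64 / m * exp (- (1 / (8 * \<omega>) * m\<^sup>2 / 4)) / S"
    using S by (intro divide_right_mono) auto
  also have "64 / m * exp (- (1 / (8 * \<omega>) * m\<^sup>2 / 4)) / S = 256 / m\<^sup>2 * inv_gauss (m / 4) \<omega>"
    using m S unfolding inv_gauss_def S_def[symmetric] by (simp add: power_divide power2_eq_square)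
  also have "\<bar>f (m + 4) - 2 * f (m + 2) + f m\<bar> / S = \<bar>f m / S - 2 * (f (m + 2) / S) + f (m + 4) / S\<bar>"
  proof -
    have "f m / S - 2 * (f (m + 2) / S) + f (m + 4) / S = (f (m + 4) - 2 * f (m + 2) + f m) / S"
      by (simp add: add_divide_distrib diff_divide_distrib)
    then show ?thesis using S by simp
  qed
  finally show ?thesis unfolding eq .
qed

section \<open>Termwise integration of the transformed series\<close>

lemma polya_gamma_density_laplace:
  fixes c :: real
  shows "set_integrable lborel {0<..} (\<lambda>\<omega>. exp (- (c\<^sup>2 * \<omega> / 2)) * polya_gamma_density \<omega>)" (is ?int)
    and "(LINT \<omega>:{0<..}|lborel. exp (- (c\<^sup>2 * \<omega> / 2)) * polya_gamma_density \<omega>) = 1 / cosh (c / 2)" (is ?eq)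
proof -
  \<comment> \<open>\<open>e\<close> is the transform at level 1/2, and \<open>q\<close> is the
    ratio between consecutive levels. The absolute value supplies the nonnegative argument required
    by \<open>inv_gauss_laplace\<close>.\<close>
  define q where "q = exp (- \<bar>c\<bar>)"
  define e where "e = exp (- (\<bar>c\<bar> / 2))"
  define K where "K = (\<lambda>n \<omega>. indicator {0<..} \<omega> *\<^sub>R
    (exp (- (c\<^sup>2 * \<omega> / 2)) * (2 * inv_gauss ((2 * real n + 1) / 2) \<omega>)))"
  define D where "D = (\<lambda>n \<omega>. (-1) ^ n * (K n \<omega> - 2 * K (n + 1) \<omega> + K (n + 2) \<omega>))"
  \<comment> \<open>A majorant of constant mass: \<open>inv_gauss_laplace\<close> at argument 0
    gives integral 1 for every \<open>n\<close>.\<close>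
  define G where "G = (\<lambda>n \<omega>. indicator {0<..} \<omega> *\<^sub>R inv_gauss ((2 * real n + 1) / 4) \<omega>)"
  have q: "0 < q" "q \<le> 1" by (auto simp: q_def)
  have K_int: "integrable lborel (K n)" and K_eq: "(\<integral>\<omega>. K n \<omega> \<partial>lborel) = 2 * e * q ^ n" for n
  proof -
    have *: "K n = (\<lambda>\<omega>. 2 * (indicator {0<..} \<omega> *\<^sub>R (exp (- (\<bar>c\<bar>\<^sup>2 * \<omega> / 2)) * inv_gauss ((2 * real n + 1) / 2) \<omega>)))"
      by (auto simp: K_def)
    have "exp (- ((2 * real n + 1) / 2) * \<bar>c\<bar>) = e * q ^ n"
      by (simp add: e_def q_def exp_of_nat_mult[symmetric] exp_add[symmetric] field_simps)
    then show "integrable lborel (K n)" "(\<integral>\<omega>. K n \<omega> \<partial>lborel) = 2 * e * q ^ n"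
      using inv_gauss_laplace[of "(2 * real n + 1) / 2" "\<bar>c\<bar>"]
      unfolding * set_integrable_def set_lebesgue_integral_def by auto
  qed
  have G_int: "integrable lborel (G n)" and G_eq: "(\<integral>\<omega>. G n \<omega> \<partial>lborel) = 1" for n
    using inv_gauss_laplace[of "(2 * real n + 1) / 4" 0]
    unfolding G_def set_integrable_def set_lebesgue_integral_def by auto
  have D_int: "integrable lborel (D n)" for n
    unfolding D_def by (intro integrable_mult_right Bochner_Integration.integrable_add
        Bochner_Integration.integrable_diff K_int)
  have D_eq: "(\<integral>\<omega>. D n \<omega> \<partial>lborel) = 2 * e * (1 - q)\<^sup>2 * (- q) ^ n" for n
  proof -
    have "(\<integral>\<omega>. D n \<omega> \<partial>lborel) = (-1) ^ n * (2 * e * q ^ n - 2 * (2 * e * q ^ (n + 1)) + 2 * e * q ^ (n + 2))"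
      unfolding D_def by (simp add: K_int K_eq del: power_Suc)
    also have "\<dots> = 2 * e * (1 - q)\<^sup>2 * (- q) ^ n"
      by (subst power_minus) (simp add: power2_eq_square algebra_simps)
    finally show ?thesis .
  qed
  have D_le: "norm (D n \<omega>) \<le> 256 * (1 / (2 * real n + 1)\<^sup>2) * G n \<omega>" for n \<omega>
  proof (cases "\<omega> > 0")
    case True
    define d where "d = 2 * inv_gauss ((2 * real n + 1) / 2) \<omega>
      - 2 * (2 * inv_gauss ((2 * real n + 1 + 2) / 2) \<omega>) + 2 * inv_gauss ((2 * real n + 1 + 4) / 2) \<omega>"
    have "norm (D n \<omega>) = exp (- (c\<^sup>2 * \<omega> / 2)) * \<bar>d\<bar>"
    proof -
      have "D n \<omega> = (-1) ^ n * (exp (- (c\<^sup>2 * \<omega> / 2)) * d)"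
        using True by (simp add: D_def K_def d_def algebra_simps)
      then show ?thesis by (simp add: abs_mult)
    qed
    \<comment> \<open>Bounding the exponential weight by 1 makes the majorant independent of
      \<open>c\<close>, including \<open>c = 0\<close>.\<close>
    also have "\<dots> \<le> 1 * \<bar>d\<bar>" using True by (intro mult_right_mono) auto
    also have "\<dots> \<le> 256 / (2 * real n + 1)\<^sup>2 * inv_gauss ((2 * real n + 1) / 4) \<omega>"
      using inv_gauss_second_difference_bound[OF True, of "2 * real n + 1"] by (simp add: d_def)
    finally show ?thesis using True by (simp add: G_def)
  qed (simp add: D_def K_def G_def)
  have K_summable: "summable (\<lambda>n. \<bar>K n \<omega>\<bar>)" for \<omega>
  proof (cases "\<omega> > 0")
    case True
    have "summable (\<lambda>n. exp (- (c\<^sup>2 * \<omega> / 2)) * \<bar>polya_gamma_term n \<omega>\<bar>)"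
      by (intro summable_mult abs_summable_polya_gamma_term True)
    then show ?thesis
      using True by (simp add: K_def polya_gamma_term_eq_inv_gauss abs_mult)
  qed (simp add: K_def)
  have D_summable: "summable (\<lambda>n. norm (D n \<omega>))" for \<omega>
  proof (rule summable_comparison_test')
    show "summable (\<lambda>n. \<bar>K n \<omega>\<bar> + 2 * \<bar>K (n + 1) \<omega>\<bar> + \<bar>K (n + 2) \<omega>\<bar>)"
      by (intro summable_add summable_mult summable_ignore_initial_segment K_summable)
    show "norm (norm (D n \<omega>)) \<le> \<bar>K n \<omega>\<bar> + 2 * \<bar>K (n + 1) \<omega>\<bar> + \<bar>K (n + 2) \<omega>\<bar>" for n
      by (simp add: D_def abs_mult)
  qed
  have D_norm_summable: "summable (\<lambda>n. \<integral>\<omega>. norm (D n \<omega>) \<partial>lborel)"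
  proof (rule summable_comparison_test')
    show "summable (\<lambda>n. 256 * (1 / (2 * real n + 1)\<^sup>2))"
      by (intro summable_mult summable_inverse_odd_squares)
    fix n
    have "(\<integral>\<omega>. norm (D n \<omega>) \<partial>lborel) \<le> (\<integral>\<omega>. 256 * (1 / (2 * real n + 1)\<^sup>2) * G n \<omega> \<partial>lborel)"
      by (intro integral_mono D_le integrable_norm D_int integrable_mult_right G_int)
    then show "norm (\<integral>\<omega>. norm (D n \<omega>) \<partial>lborel) \<le> 256 * (1 / (2 * real n + 1)\<^sup>2)"
      by (simp add: G_eq)
  qed
  note series = D_int AE_I2[OF D_summable] D_norm_summable
  \<comment> \<open>The Euler transformation solved for the alternating sum; the indicator makes
    both sides vanish off the positive half-line.\<close>
  have pointwise: "indicator {0<..} \<omega> *\<^sub>R (exp (- (c\<^sup>2 * \<omega> / 2)) * polya_gamma_density \<omega>) =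
      3 / 4 * K 0 \<omega> - 1 / 4 * K 1 \<omega> + 1 / 4 * (\<Sum>n. D n \<omega>)" for \<omega>
  proof -
    have sm: "summable (\<lambda>n. (-1) ^ n * K n \<omega>)"
      by (rule summable_norm_cancel) (simp add: abs_mult K_summable)
    have "(\<Sum>n. (-1) ^ n * K n \<omega>) = indicator {0<..} \<omega> *\<^sub>R (exp (- (c\<^sup>2 * \<omega> / 2)) * polya_gamma_density \<omega>)"
    proof (cases "\<omega> > 0")
      case True
      have "summable (\<lambda>n. polya_gamma_term n \<omega>)"
        by (rule summable_rabs_cancel[OF abs_summable_polya_gamma_term[OF True]])
      from suminf_mult[OF this, of "exp (- (c\<^sup>2 * \<omega> / 2))"] show ?thesis
        using True by (simp add: K_def polya_gamma_density_def polya_gamma_term_eq_inv_gauss mult.left_commute)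
    qed (simp add: K_def)
    moreover have "(\<Sum>n. D n \<omega>) = 4 * (\<Sum>n. (-1) ^ n * K n \<omega>) - 3 * K 0 \<omega> + K 1 \<omega>"
      unfolding D_def using sums_unique[OF alternating_sums_second_difference[OF sm]] by simp
    ultimately show ?thesis by (simp add: add_divide_distrib diff_divide_distrib)
  qed
  have S_int: "integrable lborel (\<lambda>\<omega>. \<Sum>n. D n \<omega>)" by (rule integrable_suminf[OF series])
  show ?int
    unfolding set_integrable_def pointwise
    by (intro Bochner_Integration.integrable_add Bochner_Integration.integrable_diff
        integrable_mult_right K_int S_int)
  have "(\<lambda>n. 2 * e * (1 - q)\<^sup>2 * (- q) ^ n) sums (2 * e * (1 - q)\<^sup>2 / (1 + q))"
  \<comment> \<open>At \<open>q = 1\<close>, that is \<open>c = 0\<close>, the geometric series with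
    ratio -1 diverges, but the factor \<open>(1 - q)\<^sup>2\<close> annihilates every term.\<close>
  proof (cases "q = 1")
    case False
    then show ?thesis
      using sums_mult[OF geometric_sums[of "- q"], of "2 * e * (1 - q)\<^sup>2"] q by simp
  qed simp
  then have S_eq: "(\<integral>\<omega>. (\<Sum>n. D n \<omega>) \<partial>lborel) = 2 * e * (1 - q)\<^sup>2 / (1 + q)"
    unfolding integral_suminf[OF series] D_eq by (rule sums_unique[symmetric])
  have "(LINT \<omega>:{0<..}|lborel. exp (- (c\<^sup>2 * \<omega> / 2)) * polya_gamma_density \<omega>)
      = 3 / 4 * (2 * e) - 1 / 4 * (2 * e * q) + 1 / 4 * (2 * e * (1 - q)\<^sup>2 / (1 + q))"
    unfolding set_lebesgue_integral_def pointwise by (simp add: K_int S_int K_eq S_eq)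
      (use q in \<open>simp add: field_simps\<close>)
  \<comment> \<open>Over a common denominator this rests on
    \<open>(3 - q) * (1 + q) + (1 - q)\<^sup>2 = 4\<close>.\<close>
  also have "\<dots> = 2 * e / (1 + q)"
    using q by (simp add: field_simps power2_eq_square)
  also have "\<dots> = 1 / cosh (\<bar>c\<bar> / 2)"
  proof -
    have "q = e * e" by (simp add: q_def e_def exp_add[symmetric])
    moreover have "cosh (\<bar>c\<bar> / 2) = (1 / e + e) / 2"
      by (simp add: cosh_def e_def exp_minus field_simps)
    moreover have "e > 0" "1 + e * e > 0" by (simp_all add: e_def add_pos_pos)
    ultimately show ?thesis by (simp add: field_simps)
  qed
  also have "cosh (\<bar>c\<bar> / 2) = cosh (c / 2)" by (cases "c \<ge> 0") auto
  finally show ?eq .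
qed

section \<open>The logistic function as a Gaussian mixture\<close>

theorem mainTheorem3:
  fixes \<psi> :: real
  shows "(\<forall>\<omega>>0. summable (\<lambda>n. polya_gamma_term n \<omega>))
    \<and> set_integrable lborel {0<..} (\<lambda>\<omega>. exp (- (\<psi>\<^sup>2 * \<omega> / 2)) * polya_gamma_density \<omega>)
    \<and> 1 / (1 + exp \<psi>) =
        1 / 2 * exp (- \<psi> / 2) *
        (LINT \<omega>:{0<..}|lborel. exp (- (\<psi>\<^sup>2 * \<omega> / 2)) * polya_gamma_density \<omega>)"
proof (intro conjI allI impI)
  show "summable (\<lambda>n. polya_gamma_term n \<omega>)" if "\<omega> > 0" for \<omega>
    by (rule summable_rabs_cancel[OF abs_summable_polya_gamma_term[OF that]])
  show "set_integrable lborel {0<..} (\<lambda>\<omega>. exp (- (\<psi>\<^sup>2 * \<omega> / 2)) * polya_gamma_density \<omega>)"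
    by (rule polya_gamma_density_laplace)
  \<comment> \<open>In terms of \<open>x\<close> the identity becomes the rational equation
    \<open>1 / (1 + x * x) = 1 / (2 * x) * (2 / (x + 1 / x))\<close>.\<close>
  define x where "x = exp (\<psi> / 2)"
  have x: "x > 0" by (simp add: x_def)
  have eqs: "exp \<psi> = x * x" "exp (- \<psi> / 2) = 1 / x" "cosh (\<psi> / 2) = (x + 1 / x) / 2"
    by (simp_all add: x_def exp_add[symmetric] cosh_def exp_minus field_simps)
  show "1 / (1 + exp \<psi>) = 1 / 2 * exp (- \<psi> / 2) *
        (LINT \<omega>:{0<..}|lborel. exp (- (\<psi>\<^sup>2 * \<omega> / 2)) * polya_gamma_density \<omega>)"
    unfolding polya_gamma_density_laplace eqs using x by (simp add: field_simps)
qed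

end
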